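(* Let $d\ge 3$ and let $\mu_1,\ldots,\mu_k$ be mean $0$ probability measures on $\mathbb{R}^d$ with $2+\beta$ moments, for some $\beta>0$. Let $M_i$ be the covariance matrix of $\mu_i$. Suppose that there exists a real $d\times d$ matrix $A$ such that for all $i=1,\ldots,k$ $$\mathrm{tr}(A M_i A^T) > 2\,\lambda_{\max}(A M_i A^T).$$ If $X$ is a random walk generated by $\mu_1,\ldots,\mu_k$ and an arbitrary adapted rule $\ell$, then $X$ is transient.
   Context: Conventions. $\|\cdot\|$ is the Euclidean norm on $\mathbb{R}^d$. For a matrix $B$, $B^T$ is its transpose, $\mathrm{tr}(B)$ its trace and $\lambda_{\max}(B)$ its maximum eigenvalue. A probability measure $\mu$ on $\mathbb{R}^d$ has mean $0$ if $\int_{\mathbb{R}^d} x\,\mu(dx)=0$, and has $\gamma$ moments if $\mathbb{E}[\|Z\|^{\gamma}]<\infty$ for $Z\sim\mu$. Its covariance matrix is $\mathrm{Cov}(\mu)=(\mathbb{E}[Z_iZ_j])_{i,j=1}^d$, $Z\sim\mu$. Walk generated by measures and an adapted rule. Let $\mu_1,\ldots,\mu_k$ be probability measures on $\mathbb{R}^d$ and for each $j=1,\ldots,k$ let $\xi^j_1,\xi^j_2,\ldots$ be i.i.d. with law $\mu_j$. An adapted rule $\ell=(\ell(i))_{i\ge 0}$ with respect to a filtration $(\mathcal{F}_i)_{i\ge 0}$ is a process with $\ell(i)\in\{1,\ldots,k\}$ and $\ell(i)$ $\mathcal{F}_i$-measurable for all $i$. Here the filtration represents the history of the process: $\xi^j_i$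 is $\mathcal{F}_i$-measurable for all $i\ge1$ and all $j$, and $(\xi^1_{i+1},\ldots,\xi^k_{i+1})$ is independent of $\mathcal{F}_i$ for all $i\ge 0$. The walk $X$ generated by $\mu_1,\ldots,\mu_k$ and the rule $\ell$ is defined by $X_0=0$ and $X_{i+1}=X_i+\xi^{\ell(i)}_{i+1}$. Transient means that almost surely $\|X_t\|\to\infty$ as $t\to\infty$. *)

theory Defs
  imports "HOL-Probability.Probability"
begin

definition prob_measure_on_space :: "(real ^ 'n) measure \<Rightarrow> bool" where
  "prob_measure_on_space \<mu> \<longleftrightarrow> prob_space \<mu> \<and> sets \<mu> = sets borel"

definition has_moments :: "(real ^ 'n) measure \<Rightarrow> real \<Rightarrow> bool" where
  "has_moments \<mu> \<gamma> \<longleftrightarrow> integrable \<mu> (\<lambda>z. norm z powr \<gamma>)"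

(* Integrability is required explicitly because the Bochner integral of a
   non-integrable function is 0 by convention. *)
definition has_mean_zero :: "(real ^ 'n) measure \<Rightarrow> bool" where
  "has_mean_zero \<mu> \<longleftrightarrow> integrable \<mu> (\<lambda>z. z) \<and> (\<integral>z. z \<partial>\<mu>) = 0"

(* Second moments without centring; this is the covariance for mean zero measures. *)
definition Cov :: "(real ^ 'n) measure \<Rightarrow> real ^ 'n ^ 'n" where
  "Cov \<mu> = (\<chi> i j. \<integral>z. z $ i * z $ j \<partial>\<mu>)"

definition eigenvalue :: "real ^ 'n ^ 'n \<Rightarrow> real \<Rightarrow> bool" where
  "eigenvalue B c \<longleftrightarrow> (\<exists>v. v \<noteq> 0 \<and> B *v v = c *\<^sub>R v)"

(* The set of real eigenvalues is always finite, and it is nonempty for symmetric B,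
   the only case in which lambda_max is used. *)
definition lambda_max :: "real ^ 'n ^ 'n \<Rightarrow> real" where
  "lambda_max B = Max {c. eigenvalue B c}"

(* \<xi> j i is the i-th increment with law \<mu> j, for 1 \<le> j \<le> k and i \<ge> 1; values at other
   indices are irrelevant. For a fixed time, the increments of different laws may be
   dependent: only the joint vector is required to be independent of the past. *)
locale increments =
  prob_space \<Omega> + filtration "space \<Omega>" F
  for \<Omega> :: "'a measure" and F :: "nat \<Rightarrow> 'a measure" +
  fixes k :: nat
    and \<mu> :: "nat \<Rightarrow> (real ^ 'n) measure"
    and \<xi> :: "nat \<Rightarrow> nat \<Rightarrow> 'a \<Rightarrow> real ^ 'n"
  assumes subalgebra_F: "\<And>i. subalgebra \<Omega> (F i)"
    and law: "\<And>j i. j \<in> {1..k} \<Longrightarrow> i \<ge> 1 \<Longrightarrow> distr \<Omega> borel (\<xi> j i) = \<mu> j"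
    and indep: "\<And>j. j \<in> {1..k} \<Longrightarrow> indep_vars (\<lambda>_. borel) (\<xi> j) {1..}"
    and adapted: "\<And>j i. j \<in> {1..k} \<Longrightarrow> i \<ge> 1 \<Longrightarrow> \<xi> j i \<in> borel_measurable (F i)"
    and indep_past: "\<And>i. indep_set (sets (F i))
          (sets (vimage_algebra (space \<Omega>) (\<lambda>\<omega>. \<lambda>j\<in>{1..k}. \<xi> j (i + 1) \<omega>)
                   (Pi\<^sub>M {1..k} (\<lambda>_. borel))))"

definition adapted_rule :: "(nat \<Rightarrow> 'a measure) \<Rightarrow> nat \<Rightarrow> (nat \<Rightarrow> 'a \<Rightarrow> nat) \<Rightarrow> bool" where
  "adapted_rule F k \<l> \<longleftrightarrow> (\<forall>i. \<l> i \<in> measurable (F i) (count_space {1..k}))"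

primrec walk :: "(nat \<Rightarrow> nat \<Rightarrow> 'a \<Rightarrow> real ^ 'n) \<Rightarrow> (nat \<Rightarrow> 'a \<Rightarrow> nat) \<Rightarrow> nat \<Rightarrow> 'a \<Rightarrow> real ^ 'n"
where
  "walk \<xi> \<l> 0 \<omega> = 0"
| "walk \<xi> \<l> (Suc i) \<omega> = walk \<xi> \<l> i \<omega> + \<xi> (\<l> i \<omega>) (Suc i) \<omega>"

definition transient :: "'a measure \<Rightarrow> (nat \<Rightarrow> 'a \<Rightarrow> real ^ 'n) \<Rightarrow> bool" where
  "transient \<Omega> X \<longleftrightarrow> (AE \<omega> in \<Omega>. filterlim (\<lambda>t. norm (X t \<omega>)) at_top sequentially)"

end

theory Submission
  imports Defs
begin

text \<open>
  For \<open>K\<close> large and \<open>a > 0\<close> small the potential \<open>\<phi>(x) = (K + \<parallel>A x\<parallel>\<^sup>2) powr (-a)\<close> is a strict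
  supermartingale function at every point, not only far from the origin: a step from \<open>x\<close>
  with any of the laws lowers its expectation by at least \<open>c * \<phi>(x) powr (1 + 1/a)\<close>. To second
  order the drift is \<open>-a * s powr (-a-1) * (tr B - 2 * (1+a) * (y \<bullet> B y) / s)\<close> with \<open>y = A x\<close>,
  \<open>s = K + \<parallel>y\<parallel>\<^sup>2\<close> and \<open>B = A M A\<^sup>T\<close>, which the gap \<open>tr B > 2 * \<lambda>\<^sub>m\<^sub>a\<^sub>x B\<close> makes negative.
  Summing over time bounds the sum of the expectations of \<open>\<phi>(X\<^sub>n) powr (1 + 1/a)\<close>, so this
  series converges almost surely and \<open>\<parallel>A X\<^sub>n\<parallel>\<close> tends to infinity. No martingale
  convergence or stopping times are needed.
\<close>

section \<open>Symmetric matrices and their largest eigenvalue\<close>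

text \<open>The choice \<open>t = b / (1 + \<bar>d\<bar>)\<close> makes the left side at least
  \<open>t\<^sup>2\<close>, whatever the sign of \<open>d\<close>. This replaces differentiation in
  the first-order condition at a maximiser.\<close>

lemma quadratic_nonpos_imp_linear_coeff_zero:
  fixes b d :: real
  assumes "\<And>t. b * t + d * t\<^sup>2 \<le> 0"
  shows "b = 0"
proof (rule ccontr)
  assume "b \<noteq> 0"
  define t where "t = b / (1 + \<bar>d\<bar>)"
  have "b = (1 + \<bar>d\<bar>) * t"
    by (simp add: t_def)
  moreover have "- \<bar>d\<bar> * t\<^sup>2 \<le> d * t\<^sup>2"
    by (rule mult_right_mono) auto
  ultimately have "b * t + d * t\<^sup>2 \<ge> t\<^sup>2"
    by (simp add: algebra_simps power2_eq_square)
  moreover have "t\<^sup>2 > 0"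
    using \<open>b \<noteq> 0\<close> by (simp add: t_def)
  ultimately show False
    using assms[of t] by linarith
qed

lemma inner_symmetric_matrix:
  fixes B :: "real ^ 'n ^ 'n"
  assumes "transpose B = B"
  shows "(B *v x) \<bullet> y = x \<bullet> (B *v y)"
  by (metis assms dot_lmul_matrix transpose_matrix_vector)

text \<open>Eigenvectors to distinct eigenvalues are orthogonal, so one nonzero eigenvector per
  eigenvalue gives an independent set, which is finite in finite dimension. Finiteness is what makes
  \<open>Max\<close> in \<open>lambda_max\<close> an upper bound.\<close>

lemma finite_eigenvalues_symmetric:
  fixes B :: "real ^ 'n ^ 'n"
  assumes sym: "transpose B = B"
  shows "finite {c. eigenvalue B c}"
proof -
  have "\<forall>c\<in>{c. eigenvalue B c}. \<exists>v. v \<noteq> 0 \<and> B *v v = c *\<^sub>R v"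
    by (simp add: eigenvalue_def)
  then obtain f where f: "\<And>c. eigenvalue B c \<Longrightarrow> f c \<noteq> 0 \<and> B *v f c = c *\<^sub>R f c"
    by (metis mem_Collect_eq)
  have orth: "f c \<bullet> f d = 0" if "eigenvalue B c" "eigenvalue B d" "c \<noteq> d" for c d
    using inner_symmetric_matrix[OF sym, of "f c" "f d"] f that by simp
  have inj: "inj_on f {c. eigenvalue B c}"
    by (rule inj_onI) (metis f inner_eq_zero_iff mem_Collect_eq orth)
  have "pairwise orthogonal (f ` {c. eigenvalue B c})"
    unfolding pairwise_def orthogonal_def using orth by blast
  moreover have "0 \<notin> f ` {c. eigenvalue B c}"
    using f by fastforce
  ultimately have "finite (f ` {c. eigenvalue B c})"
    using pairwise_orthogonal_independent independent_imp_finite by blast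
  then show ?thesis
    using finite_imageD inj by blast
qed

text \<open>A maximiser of the quadratic form on the unit sphere is an eigenvector.\<close>

lemma quadratic_form_le_lambda_max:
  fixes B :: "real ^ 'n ^ 'n"
  assumes sym: "transpose B = B"
  shows "x \<bullet> (B *v x) \<le> lambda_max B * (norm x)\<^sup>2"
proof -
  let ?S = "sphere (0 :: real ^ 'n) 1"
  have "continuous_on ?S (\<lambda>x. x \<bullet> (B *v x))"
    by (intro continuous_intros linear_continuous_on) (simp add: linear_linear)
  then obtain v where v: "norm v = 1" and vmax: "\<And>x. norm x = 1 \<Longrightarrow> x \<bullet> (B *v x) \<le> v \<bullet> (B *v v)"
    using continuous_attains_sup[of ?S "\<lambda>x. x \<bullet> (B *v x)"] by (force simp: dist_norm)
  define m where "m = v \<bullet> (B *v v)"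
  have le: "x \<bullet> (B *v x) \<le> m * (norm x)\<^sup>2" for x
  proof (cases "x = 0")
    case False
    have "(x /\<^sub>R norm x) \<bullet> (B *v (x /\<^sub>R norm x)) \<le> m"
      unfolding m_def using False by (intro vmax) simp
    then show ?thesis
      using False by (simp add: matrix_vector_mult_scaleR field_simps power2_eq_square)
  qed simp
  have "v \<bullet> v = 1"
    using v by (simp add: norm_eq_1)
  \<comment> \<open>The residual \<open>w\<close> vanishes exactly when \<open>v\<close> is an
    eigenvector for \<open>m\<close>; it also serves as the direction in which the maximiser is
    perturbed.\<close>
  define w where "w = B *v v - m *\<^sub>R v"
  have vw: "v \<bullet> (B *v w) = w \<bullet> (B *v v)"
    using inner_symmetric_matrix[OF sym, of v w] by (simp add: inner_commute)
  have ww: "w \<bullet> w = w \<bullet> (B *v v) - m * (w \<bullet> v)"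
    by (simp add: w_def inner_diff_right)
  \<comment> \<open>The bound \<open>le\<close> at \<open>v + t *\<^sub>R w\<close> is an inequality
    between polynomials in \<open>t\<close>: the constant terms cancel, and by \<open>ww\<close> the
    linear coefficient is \<open>2 * (w \<bullet> w)\<close>.\<close>
  have "2 * (w \<bullet> w) * t + (w \<bullet> (B *v w) - m * (w \<bullet> w)) * t\<^sup>2 \<le> 0" for t
  proof -
    have "(v + t *\<^sub>R w) \<bullet> (B *v (v + t *\<^sub>R w))
        = m + 2 * t * (w \<bullet> (B *v v)) + t\<^sup>2 * (w \<bullet> (B *v w))"
      using vw by (simp add: matrix_vector_right_distrib matrix_vector_mult_scaleR inner_add_left
          inner_add_right m_def power2_eq_square algebra_simps)
    moreover have "(norm (v + t *\<^sub>R w))\<^sup>2 = 1 + 2 * t * (w \<bullet> v) + t\<^sup>2 * (w \<bullet> w)"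
      using \<open>v \<bullet> v = 1\<close> unfolding power2_norm_eq_inner
      by (simp add: inner_add_left inner_add_right inner_commute[of v w] power2_eq_square algebra_simps)
    ultimately have "m + 2 * t * (w \<bullet> (B *v v)) + t\<^sup>2 * (w \<bullet> (B *v w))
        \<le> m * (1 + 2 * t * (w \<bullet> v) + t\<^sup>2 * (w \<bullet> w))"
      using le[of "v + t *\<^sub>R w"] by simp
    then show ?thesis
      unfolding ww by (simp add: algebra_simps)
  qed
  from quadratic_nonpos_imp_linear_coeff_zero[OF this] have "w = 0"
    by simp
  then have "eigenvalue B m"
    unfolding eigenvalue_def w_def using v by (intro exI[of _ v]) auto
  then have "m \<le> lambda_max B"
    unfolding lambda_max_def using finite_eigenvalues_symmetric[OF sym] by simp
  then show ?thesis
    using le[of x] by (meson mult_right_mono order_trans zero_le_power2)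
qed

section \<open>Pointwise estimates for the potential\<close>

text \<open>Second-order Taylor expansion at 0 with Lagrange remainder: the second derivative
  \<open>a * (a + 1) * (1 + t) powr (-a - 2)\<close> decreases in \<open>t\<close>, so its value at
  \<open>-\<rho>\<close> bounds it.\<close>

lemma one_plus_powr_le:
  fixes a u \<rho> :: real
  assumes "0 < a" "\<bar>u\<bar> \<le> \<rho>" "\<rho> < 1"
  shows "(1 + u) powr (-a) \<le> 1 - a * u + a * (a + 1) / 2 * (1 - \<rho>) powr (-a - 2) * u\<^sup>2"
proof (cases "u = 0")
  case False
  \<comment> \<open>For \<open>m \<le> 2\<close> this is the \<open>m\<close>-th derivative, in the
    form that \<open>Taylor\<close> expects. \<open>Taylor\<close> also needs a nonzero increment,
    whence the separate case \<open>u = 0\<close>.\<close>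
  define f where "f m t = (if m = 0 then (1 + t) powr (-a) else
      if m = 1 then (-a) * (1 + t) powr (-a - 1) else a * (a + 1) * (1 + t) powr (-a - 2))"
    for m :: nat and t :: real
  have "DERIV (f m) t :> f (Suc m) t" if "m < 2" "-\<rho> \<le> t" "t \<le> \<rho>" for m t
  proof -
    have t: "1 + t > 0"
      using that assms by linarith
    consider "m = 0" | "m = 1"
      using \<open>m < 2\<close> by linarith
    then show ?thesis
    proof cases
      case 1
      have "f 0 = (\<lambda>t. (1 + t) powr (-a))"
        by (simp add: f_def fun_eq_iff)
      then show ?thesis
        using 1 t by (auto simp: f_def intro!: derivative_eq_intros)
    next
      case 2
      have "f 1 = (\<lambda>t. (-a) * (1 + t) powr (-a - 1))"
        by (simp add: f_def fun_eq_iff)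
      then show ?thesis
        using 2 t by (auto simp: f_def algebra_simps intro!: derivative_eq_intros)
    qed
  qed
  then have D: "\<forall>m t. m < 2 \<and> -\<rho> \<le> t \<and> t \<le> \<rho> \<longrightarrow> DERIV (f m) t :> f (Suc m) t"
    by blast
  have f0: "f 0 = (\<lambda>t. (1 + t) powr (-a))"
    by (simp add: f_def fun_eq_iff)
  have "-\<rho> \<le> 0" "0 \<le> \<rho>" "-\<rho> \<le> u" "u \<le> \<rho>"
    using assms by linarith+
  from Taylor[OF pos2 f0 D this False] obtain t
    where t: "if u < 0 then u < t \<and> t < 0 else 0 < t \<and> t < u"
      and eq: "(1 + u) powr (-a) = (\<Sum>m<2. f m 0 / fact m * (u - 0) ^ m) + f 2 t / fact 2 * (u - 0)\<^sup>2"
    by blast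
  have "t \<ge> -\<rho>"
    using t assms by (auto split: if_splits)
  then have "(1 + t) powr (-a - 2) \<le> (1 - \<rho>) powr (-a - 2)"
    using assms by (intro powr_mono2') auto
  then have "a * (a + 1) / 2 * (1 + t) powr (-a - 2) * u\<^sup>2
      \<le> a * (a + 1) / 2 * (1 - \<rho>) powr (-a - 2) * u\<^sup>2"
    using assms by (intro mult_right_mono mult_left_mono) auto
  moreover have "(1 + u) powr (-a) = 1 - a * u + a * (a + 1) / 2 * (1 + t) powr (-a - 2) * u\<^sup>2"
    using eq by (simp add: f_def numeral_2_eq_2)
  ultimately show ?thesis
    by simp
qed simp

text \<open>
  The error term is split at \<open>\<parallel>z\<parallel> = \<eta> * sqrt s\<close>: below, it is a small multiple of the
  quadratic terms; above, the last summand alone dominates everything.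
\<close>

lemma potential_step_le:
  fixes y z :: "'v::real_inner" and a \<beta> \<eta> K s :: real
  defines "s \<equiv> K + (norm y)\<^sup>2"
  assumes a: "0 < a" and \<eta>: "0 < \<eta>" "\<eta> * (2 + \<eta>) < 1" and K: "1 \<le> K" and \<beta>: "0 < \<beta>"
  shows "(K + (norm (y + z))\<^sup>2) powr (-a) \<le> s powr (-a) *
    (1 - a * (2 * (y \<bullet> z) + (norm z)\<^sup>2) / s
       + a * (a + 1) / 2 * (1 - \<eta> * (2 + \<eta>)) powr (-a - 2)
           * (4 * (y \<bullet> z)\<^sup>2 / s\<^sup>2 + (4 * \<eta> + \<eta>\<^sup>2) * (norm z)\<^sup>2 / s)
       + (1 + 3 * a) * s powr a * (norm z / (\<eta> * sqrt s)) powr (2 + \<beta>))"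
    (is "_ \<le> _ * (1 - ?L + ?q * ?Q + ?R)")
proof -
  \<comment> \<open>\<open>w\<close> is the step length on the scale \<open>sqrt s\<close>, and
    \<open>u\<close> is the relative change of \<open>s\<close> caused by the step, so the new value
    is \<open>s * (1 + u)\<close>.\<close>
  define w where "w = norm z / sqrt s"
  define u where "u = (2 * (y \<bullet> z) + (norm z)\<^sup>2) / s"
  have s: "s \<ge> 1" "(norm y)\<^sup>2 \<le> s"
    unfolding s_def using K by (auto simp: add_increasing2)
  have "\<eta> < 1"
    using \<eta> mult_mono[of 1 \<eta> 1 "2 + \<eta>"] by linarith
  have w: "w \<ge> 0" "w\<^sup>2 = (norm z)\<^sup>2 / s"
    using s by (auto simp: w_def power_divide)
  have "norm y \<le> sqrt s"
    using s by (simp add: real_le_rsqrt)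
  have "\<bar>y \<bullet> z\<bar> \<le> norm y * norm z"
    by (rule Cauchy_Schwarz_ineq2)
  also have "\<dots> \<le> sqrt s * norm z"
    using \<open>norm y \<le> sqrt s\<close> by (intro mult_right_mono) auto
  finally have "\<bar>y \<bullet> z\<bar> / s \<le> sqrt s * norm z / s"
    using s by (simp add: divide_right_mono)
  also have "\<dots> = w"
    using s by (simp add: w_def field_simps)
  finally have yz: "\<bar>(y \<bullet> z) / s\<bar> \<le> w"
    using s by simp
  have u_eq: "u = 2 * ((y \<bullet> z) / s) + w\<^sup>2"
    by (simp add: u_def w add_divide_distrib)
  have "K + (norm (y + z))\<^sup>2 = s * (1 + u)"
    using s by (simp add: u_def s_def field_simps power2_norm_eq_inner inner_add_left inner_add_right inner_commute)
  moreover have "K + (norm (y + z))\<^sup>2 \<ge> 1"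
    using K by (simp add: add_increasing2)
  ultimately have u1: "1 + u \<ge> 1 / s" and "1 + u > 0" and eq: "K + (norm (y + z))\<^sup>2 = s * (1 + u)"
    using s by (auto simp: field_simps intro: order.strict_trans2[of 0 "1 / s"])
  then have lhs: "(K + (norm (y + z))\<^sup>2) powr (-a) = s powr (-a) * (1 + u) powr (-a)"
    unfolding eq by (intro powr_mult)
  have Q: "?q * ?Q \<ge> 0"
    using a \<eta> s by (intro mult_nonneg_nonneg add_nonneg_nonneg divide_nonneg_nonneg) auto
  have R: "?R = (1 + 3 * a) * s powr a * (w / \<eta>) powr (2 + \<beta>)"
    by (simp add: w_def field_simps)
  have "(1 + u) powr (-a) \<le> 1 - ?L + ?q * ?Q + ?R"
  proof (cases "w \<le> \<eta>")
    case True
    have "\<bar>u\<bar> \<le> 2 * w + w\<^sup>2"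
      using yz zero_le_power2[of w] unfolding u_eq by linarith
    also have "\<dots> \<le> \<eta> * (2 + \<eta>)"
      using True w power_mono[of w \<eta> 2] by (simp add: algebra_simps power2_eq_square)
    finally have "(1 + u) powr (-a) \<le> 1 - a * u + ?q * u\<^sup>2"
      using one_plus_powr_le[of a u "\<eta> * (2 + \<eta>)"] a \<eta> by simp
    \<comment> \<open>Only \<open>4 * (y \<bullet> z)\<^sup>2 / s\<^sup>2\<close> is kept exactly,
      since its constant competes with the trace. The other terms of the square carry a factor
      \<open>w\<^sup>2\<close> and a coefficient that is small with \<open>\<eta>\<close>.\<close>
    also have "u\<^sup>2 \<le> ?Q"
    proof -
      have "u\<^sup>2 = 4 * (y \<bullet> z)\<^sup>2 / s\<^sup>2 + (4 * ((y \<bullet> z) / s) + w\<^sup>2) * w\<^sup>2"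
        by (simp add: u_eq power2_eq_square algebra_simps)
      moreover have "4 * ((y \<bullet> z) / s) + w\<^sup>2 \<le> 4 * \<eta> + \<eta>\<^sup>2"
        using abs_le_D1[OF yz] True power_mono[OF True w(1), of 2] by linarith
      then have "(4 * ((y \<bullet> z) / s) + w\<^sup>2) * w\<^sup>2 \<le> (4 * \<eta> + \<eta>\<^sup>2) * w\<^sup>2"
        by (rule mult_right_mono) simp
      ultimately show ?thesis
        by (simp add: w)
    qed
    then have "1 - a * u + ?q * u\<^sup>2 \<le> 1 - a * u + ?q * ?Q"
      using a by (intro add_left_mono mult_left_mono) auto
    also have "\<dots> \<le> 1 - ?L + ?q * ?Q + ?R"
      using a by (simp add: u_def)
    finally show ?thesis .
  next
    case False
    \<comment> \<open>In this case \<open>W\<close> dominates \<open>1\<close>, \<open>w\<close> and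
      \<open>w\<^sup>2\<close>. Of the constant \<open>1 + 3 * a\<close>, the \<open>1\<close> pays
      for the left side and \<open>3 * a\<close> for the subtracted term
      \<open>a * u \<le> a * (2 * w + w\<^sup>2)\<close>.\<close>
    define W where "W = (w / \<eta>) powr (2 + \<beta>)"
    have 1: "w / \<eta> \<ge> 1"
      using False \<eta> by simp
    have W: "1 \<le> W"
      unfolding W_def using 1 \<beta> by (intro ge_one_powr_ge_zero) auto
    have "w \<le> w / \<eta>"
      using w \<eta> \<open>\<eta> < 1\<close> by (simp add: le_divide_eq mult_right_le_one_le)
    have "(w / \<eta>)\<^sup>2 \<le> W"
      unfolding W_def using 1 \<beta> powr_mono[of 2 "2 + \<beta>" "w / \<eta>"] by simp
    moreover have "w\<^sup>2 \<le> (w / \<eta>)\<^sup>2"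
      using w \<open>w \<le> w / \<eta>\<close> by (intro power_mono)
    ultimately have W2: "w\<^sup>2 \<le> W"
      by simp
    have "w / \<eta> \<le> (w / \<eta>)\<^sup>2"
      using 1 self_le_power[of "w / \<eta>" 2] by simp
    then have W1: "w \<le> W"
      using \<open>(w / \<eta>)\<^sup>2 \<le> W\<close> \<open>w \<le> w / \<eta>\<close> by simp
    have sa: "s powr a \<ge> 1"
      using s a by (intro ge_one_powr_ge_zero) auto
    have "(1 + u) powr (-a) \<le> (1 / s) powr (-a)"
      using u1 s a by (intro powr_mono2') auto
    also have "\<dots> = s powr a"
      using s by (simp add: powr_divide powr_minus_divide)
    also have "\<dots> \<le> s powr a * W"
      using sa W by (simp add: mult_le_cancel_left1)
    finally have A: "(1 + u) powr (-a) \<le> s powr a * W" .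
    have "u \<le> 2 * w + w\<^sup>2"
      using abs_le_D1[OF yz] unfolding u_eq by linarith
    also have "\<dots> \<le> 3 * W"
      using W1 W2 by simp
    also have "\<dots> \<le> 3 * (s powr a * W)"
      using sa W by (simp add: mult_le_cancel_left1)
    finally have "a * u \<le> a * (3 * (s powr a * W))"
      using a by (intro mult_left_mono) auto
    moreover have "?L = a * u"
      by (simp add: u_def)
    moreover have "?R = s powr a * W + a * (3 * (s powr a * W))"
      unfolding R W_def by (simp add: algebra_simps)
    ultimately show ?thesis
      using A Q by linarith
  qed
  then show ?thesis
    unfolding lhs by (intro mult_left_mono) auto
qed

section \<open>Expected change of the potential in one step\<close>

text \<open>Since \<open>t\<^sup>2 \<le> 1 + t powr (2 + \<beta>)\<close> for
  \<open>t \<ge> 0\<close> and constants are integrable, the single moment assumption covers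
  everything of at most quadratic size.\<close>

lemma (in prob_space) integrable_of_bound_powr_moment:
  fixes Z :: "'a \<Rightarrow> 'v::euclidean_space" and f :: "'a \<Rightarrow> 'w::euclidean_space"
  assumes f: "f \<in> borel_measurable M"
    and "integrable M (\<lambda>x. norm (Z x) powr (2 + \<beta>))" "0 < \<beta>"
    and bound: "\<And>x. norm (f x) \<le> C * (norm (Z x))\<^sup>2"
  shows "integrable M f"
proof (rule Bochner_Integration.integrable_bound[OF _ f])
  show "integrable M (\<lambda>x. \<bar>C\<bar> * (1 + norm (Z x) powr (2 + \<beta>)))"
    using assms by simp
  have "(norm (Z x))\<^sup>2 \<le> 1 + norm (Z x) powr (2 + \<beta>)" for x
  proof (cases "norm (Z x) \<le> 1")
    case True
    then have "(norm (Z x))\<^sup>2 \<le> 1"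
      by (simp add: power_le_one)
    then show ?thesis
      by (simp add: add_increasing2)
  next
    case False
    then have "norm (Z x) powr 2 \<le> norm (Z x) powr (2 + \<beta>)"
      using \<open>0 < \<beta>\<close> by (intro powr_mono) auto
    then show ?thesis
      using False by simp
  qed
  then have "norm (f x) \<le> \<bar>C\<bar> * (1 + norm (Z x) powr (2 + \<beta>))" for x
    by (meson abs_ge_self abs_ge_zero bound mult_left_mono mult_right_mono order_trans zero_le_power2)
  then show "AE x in M. norm (f x) \<le> norm (\<bar>C\<bar> * (1 + norm (Z x) powr (2 + \<beta>)))"
    by (intro AE_I2) (smt (verit) real_norm_def)
qed

text \<open>Under expectation in \<open>potential_step_le\<close>, mean zero removes the linear
  term, and for small \<open>\<eta>\<close> the quadratic terms give a relative decrease close to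
  \<open>a * (\<tau> - 2 * (a + 1) * lam) / s\<close> or larger, where \<open>\<tau>\<close> is the
  expectation of \<open>(norm (Z x))\<^sup>2\<close>. The nested filters let \<open>K\<close> depend
  on \<open>a\<close> and \<open>c\<close> on both, and they allow finitely many laws to be combined
  without comparing constants.\<close>

lemma (in prob_space) potential_drift:
  fixes Z :: "'a \<Rightarrow> 'v::euclidean_space" and \<beta> lam :: real
  assumes Z[measurable]: "Z \<in> borel_measurable M"
    and int: "integrable M Z" and mean: "expectation Z = 0"
    and \<beta>: "0 < \<beta>" and mom: "integrable M (\<lambda>x. norm (Z x) powr (2 + \<beta>))"
    and lam: "\<And>v. expectation (\<lambda>x. (v \<bullet> Z x)\<^sup>2) \<le> lam * (norm v)\<^sup>2"
    and gap: "2 * lam < expectation (\<lambda>x. (norm (Z x))\<^sup>2)"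
  shows "\<forall>\<^sub>F a in at_right 0. \<forall>\<^sub>F K in at_top. \<forall>\<^sub>F c in at_right 0.
    \<forall>y. expectation (\<lambda>x. (K + (norm (y + Z x))\<^sup>2) powr (-a))
      \<le> (K + (norm y)\<^sup>2) powr (-a) - c * (K + (norm y)\<^sup>2) powr (-a - 1)"
proof -
  define \<tau> where "\<tau> = expectation (\<lambda>x. (norm (Z x))\<^sup>2)"
  define m where "m = expectation (\<lambda>x. norm (Z x) powr (2 + \<beta>))"
  note bd = integrable_of_bound_powr_moment[OF _ mom \<beta>]
  have int2: "integrable M (\<lambda>x. (norm (Z x))\<^sup>2)"
    by (rule bd[where C = 1]) auto
  have inti: "integrable M (\<lambda>x. (v \<bullet> Z x)\<^sup>2)" for v
    by (rule bd[where C = "(norm v)\<^sup>2"])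
      (auto simp flip: power_mult_distrib intro!: abs_le_square_iff[THEN iffD1] simp: Cauchy_Schwarz_ineq2)
  \<comment> \<open>The second-moment bound is tested on a unit basis vector. The sign is used below
    to replace \<open>(norm y)\<^sup>2\<close> by \<open>s\<close>.\<close>
  have lam0: "lam \<ge> 0"
  proof -
    have "0 \<le> lam * (norm (SOME b. b \<in> Basis :: 'v))\<^sup>2"
      by (rule order_trans[OF _ lam]) simp
    then show ?thesis
      by (simp add: norm_Basis[OF some_in_eq[THEN iffD2]])
  qed
  \<comment> \<open>This bound on \<open>a\<close> makes the moment error
    \<open>s powr (a - \<beta> / 2)\<close> decay; the next one keeps the gap strict when the factor
    \<open>2\<close> worsens to \<open>2 * (a + 1)\<close>.\<close>
  have "\<forall>\<^sub>F a in at_right 0. a < \<beta> / 2"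
    using \<beta> by (intro order_tendstoD(2)[OF tendsto_ident_at]) simp
  moreover have "\<forall>\<^sub>F a in at_right 0. 2 * (a + 1) * lam < \<tau>"
  proof (rule order_tendstoD)
    show "((\<lambda>a. 2 * (a + 1) * lam) \<longlongrightarrow> 2 * (0 + 1) * lam) (at_right 0)"
      by (intro tendsto_intros)
    show "2 * (0 + 1) * lam < \<tau>"
      using gap by (simp add: \<tau>_def)
  qed
  moreover have "\<forall>\<^sub>F a :: real in at_right 0. a > 0"
    by (simp add: eventually_at_right_less)
  ultimately show ?thesis
  proof eventually_elim
    case (elim a)
    define q where "q \<eta> = a * (a + 1) / 2 * (1 - \<eta> * (2 + \<eta>)) powr (-a - 2)" for \<eta>
    \<comment> \<open>\<open>G \<eta> / s\<close> is the relative decrease before the moment term is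
      charged. Its coefficient has a positive limit at 0 by the choice of \<open>a\<close>.\<close>
    define G where "G \<eta> = a * \<tau> - q \<eta> * (4 * lam + (4 * \<eta> + \<eta>\<^sup>2) * \<tau>)" for \<eta>
    have "\<forall>\<^sub>F \<eta> in at_right 0. G \<eta> > 0"
    proof (rule order_tendstoD)
      show "(G \<longlongrightarrow> a * \<tau> - a * (a + 1) / 2 * (1 - 0 * (2 + 0)) powr (-a - 2)
                * (4 * lam + (4 * 0 + 0\<^sup>2) * \<tau>)) (at_right 0)"
        unfolding G_def q_def by (intro tendsto_intros) auto
      have "0 < a * (\<tau> - 2 * (a + 1) * lam)"
        using elim by simp
      then show "0 < a * \<tau> - a * (a + 1) / 2 * (1 - 0 * (2 + 0)) powr (-a - 2)
                * (4 * lam + (4 * 0 + 0\<^sup>2) * \<tau>)"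
        by (simp add: algebra_simps)
    qed
    moreover have "\<forall>\<^sub>F \<eta> in at_right 0. \<eta> * (2 + \<eta>) < (1 :: real)"
    proof (rule order_tendstoD)
      show "((\<lambda>\<eta>. \<eta> * (2 + \<eta>)) \<longlongrightarrow> 0 * (2 + 0 :: real)) (at_right 0)"
        by (intro tendsto_intros)
    qed simp
    moreover have "\<forall>\<^sub>F \<eta> :: real in at_right 0. \<eta> > 0"
      by (simp add: eventually_at_right_less)
    ultimately have "\<forall>\<^sub>F \<eta> in at_right 0. G \<eta> > 0 \<and> \<eta> * (2 + \<eta>) < 1 \<and> \<eta> > 0"
      by eventually_elim simp
    then obtain \<eta> where \<eta>: "G \<eta> > 0" "\<eta> * (2 + \<eta>) < 1" "\<eta> > 0"
      using eventually_happens trivial_limit_at_right_real by blast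
    define D where "D = (1 + 3 * a) * (1 / \<eta>) powr (2 + \<beta>)"
    have D0: "D \<ge> 0"
      using elim by (simp add: D_def)
    have m0: "m \<ge> 0"
      by (simp add: m_def)
    \<comment> \<open>Half of \<open>G \<eta>\<close> is reserved for the moment term; the other
      half is left as room for \<open>c\<close>.\<close>
    have "((\<lambda>K. D * m * K powr (a - \<beta> / 2)) \<longlongrightarrow> D * m * 0) at_top"
      using elim by (intro tendsto_intros tendsto_neg_powr filterlim_ident) auto
    then have "\<forall>\<^sub>F K in at_top. D * m * K powr (a - \<beta> / 2) < G \<eta> / 2"
      by (rule order_tendstoD) (use \<eta> in auto)
    moreover have "\<forall>\<^sub>F K :: real in at_top. K \<ge> 1"
      by (rule eventually_ge_at_top)
    ultimately show ?case
    proof eventually_elim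
      case K: (elim K)
      have bound: "expectation (\<lambda>x. (K + (norm (y + Z x))\<^sup>2) powr (-a))
          \<le> (K + (norm y)\<^sup>2) powr (-a) - c * (K + (norm y)\<^sup>2) powr (-a - 1)"
        if c: "c \<le> G \<eta> / 2" for c y
      proof -
        define s where "s = K + (norm y)\<^sup>2"
        have s: "s \<ge> K" "(norm y)\<^sup>2 \<le> s" "s > 0" "s \<ge> 1"
          using K by (auto simp: s_def add_increasing2 add_pos_nonneg)
        \<comment> \<open>The majorant of \<open>potential_step_le\<close>, regrouped by the
          functions of \<open>Z x\<close> that occur in it, so that its expectation can be taken
          term by term.\<close>
        define B where "B x = s powr (-a) * (1 - 2 * a / s * (y \<bullet> Z x)
            - (a / s - q \<eta> * (4 * \<eta> + \<eta>\<^sup>2) / s) * (norm (Z x))\<^sup>2 + 4 * q \<eta> / s\<^sup>2 * (y \<bullet> Z x)\<^sup>2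
            + D * s powr (a - \<beta> / 2 - 1) * norm (Z x) powr (2 + \<beta>))" for x
        have le: "(K + (norm (y + Z x))\<^sup>2) powr (-a) \<le> B x" for x
        proof -
          have "sqrt s powr (2 + \<beta>) = s powr (1 + \<beta> / 2)"
            using s by (simp add: powr_half_sqrt[symmetric] powr_powr field_simps)
          then have "s powr a * (norm (Z x) / (\<eta> * sqrt s)) powr (2 + \<beta>)
              = (1 / \<eta>) powr (2 + \<beta>) * (s powr a / s powr (1 + \<beta> / 2)) * norm (Z x) powr (2 + \<beta>)"
            using s \<eta> by (simp add: powr_divide powr_mult)
          also have "s powr a / s powr (1 + \<beta> / 2) = s powr (a - \<beta> / 2 - 1)"
            by (simp add: powr_diff[symmetric] algebra_simps)
          finally have "(1 + 3 * a) * s powr a * (norm (Z x) / (\<eta> * sqrt s)) powr (2 + \<beta>)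
              = D * s powr (a - \<beta> / 2 - 1) * norm (Z x) powr (2 + \<beta>)"
            by (simp add: D_def mult.assoc)
          then show ?thesis
            using potential_step_le[of a \<eta> K \<beta> y "Z x", folded s_def q_def] elim \<eta> K \<beta>
            unfolding B_def by (simp add: diff_divide_distrib add_divide_distrib algebra_simps)
        qed
        have yZ: "integrable M (\<lambda>x. y \<bullet> Z x)" "expectation (\<lambda>x. y \<bullet> Z x) = 0"
          using int mean by auto
        have intB: "integrable M B"
          unfolding B_def using yZ int2 inti mom by auto
        have "expectation (\<lambda>x. (K + (norm (y + Z x))\<^sup>2) powr (-a)) \<le> expectation B"
        proof (rule integral_mono[OF _ intB le])
          show "integrable M (\<lambda>x. (K + (norm (y + Z x))\<^sup>2) powr (-a))"
            by (rule Bochner_Integration.integrable_bound[OF intB])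
              (auto intro!: AE_I2 order_trans[OF le])
        qed
        also have "expectation B = s powr (-a) * (1
            - (a / s - q \<eta> * (4 * \<eta> + \<eta>\<^sup>2) / s) * \<tau> + 4 * q \<eta> / s\<^sup>2 * expectation (\<lambda>x. (y \<bullet> Z x)\<^sup>2)
            + D * s powr (a - \<beta> / 2 - 1) * m)"
          unfolding B_def \<tau>_def m_def using yZ int2 inti mom by (simp add: prob_space)
        also have "\<dots> \<le> s powr (-a) * (1 - c / s)"
        proof (rule mult_left_mono)
          have "q \<eta> \<ge> 0"
            using elim by (simp add: q_def)
          have "expectation (\<lambda>x. (y \<bullet> Z x)\<^sup>2) \<le> lam * s"
            using lam[of y] mult_left_mono[OF s(2) lam0] by linarith
          then have "4 * q \<eta> / s\<^sup>2 * expectation (\<lambda>x. (y \<bullet> Z x)\<^sup>2) \<le> 4 * q \<eta> / s\<^sup>2 * (lam * s)"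
            using \<open>q \<eta> \<ge> 0\<close> by (intro mult_left_mono) auto
          also have "\<dots> = 4 * q \<eta> * lam / s"
            using s by (simp add: power2_eq_square)
          finally have 1: "4 * q \<eta> / s\<^sup>2 * expectation (\<lambda>x. (y \<bullet> Z x)\<^sup>2) \<le> 4 * q \<eta> * lam / s" .
          \<comment> \<open>As \<open>s \<ge> K\<close> and the exponent is negative, the choice of
            \<open>K\<close> controls the error for every \<open>y\<close>, including those near
            0.\<close>
          have "s powr (a - \<beta> / 2) \<le> K powr (a - \<beta> / 2)"
            using s K elim by (intro powr_mono2') auto
          then have "D * m * s powr (a - \<beta> / 2) \<le> D * m * K powr (a - \<beta> / 2)"
            using D0 m0 by (intro mult_left_mono) auto
          then have "D * m * s powr (a - \<beta> / 2) / s \<le> G \<eta> / 2 / s"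
            using K s by (intro divide_right_mono) auto
          moreover have "s powr (a - \<beta> / 2 - 1) = s powr (a - \<beta> / 2) / s"
            using s by (simp add: powr_diff)
          ultimately have 2: "D * s powr (a - \<beta> / 2 - 1) * m \<le> G \<eta> / 2 / s"
            by (simp add: mult_ac)
          have 3: "(a / s - q \<eta> * (4 * \<eta> + \<eta>\<^sup>2) / s) * \<tau> = G \<eta> / s + 4 * q \<eta> * lam / s"
            by (simp add: G_def algebra_simps add_divide_distrib diff_divide_distrib)
          have "c / s \<le> G \<eta> / 2 / s"
            using c s by (intro divide_right_mono) auto
          moreover have "G \<eta> / s = G \<eta> / 2 / s + G \<eta> / 2 / s"
            by simp
          ultimately show "1 - (a / s - q \<eta> * (4 * \<eta> + \<eta>\<^sup>2) / s) * \<tau>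
              + 4 * q \<eta> / s\<^sup>2 * expectation (\<lambda>x. (y \<bullet> Z x)\<^sup>2)
              + D * s powr (a - \<beta> / 2 - 1) * m \<le> 1 - c / s"
            using 1 2 3 by linarith
        qed simp
        also have "\<dots> = s powr (-a) - c * s powr (-a - 1)"
          using s by (simp add: powr_diff right_diff_distrib)
        finally show ?thesis
          by (simp add: s_def)
      qed
      have "\<forall>\<^sub>F c in at_right 0. c \<le> G \<eta> / 2"
        using \<eta> by (intro eventually_mono[OF order_tendstoD(2)[OF tendsto_ident_at, of 0 "G \<eta> / 2"]]) auto
      then show ?case
        by eventually_elim (use bound in blast)
    qed
  qed
qed

section \<open>Covariance matrices and the trace condition\<close>

lemma Cov_quadratic_form:
  fixes \<mu> :: "(real ^ 'n) measure"
  assumes "\<And>i j. integrable \<mu> (\<lambda>z. z $ i * z $ j)"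
  shows "(\<integral>z. (w \<bullet> z)\<^sup>2 \<partial>\<mu>) = w \<bullet> (Cov \<mu> *v w)"
proof -
  have "(\<integral>z. (w \<bullet> z)\<^sup>2 \<partial>\<mu>) = (\<integral>z. (\<Sum>i\<in>UNIV. \<Sum>j\<in>UNIV. w $ i * w $ j * (z $ i * z $ j)) \<partial>\<mu>)"
    by (simp add: inner_vec_def power2_eq_square sum_product mult_ac)
  also have "\<dots> = (\<Sum>i\<in>UNIV. \<Sum>j\<in>UNIV. w $ i * w $ j * (\<integral>z. z $ i * z $ j \<partial>\<mu>))"
    using assms by (simp add: Bochner_Integration.integral_sum)
  also have "\<dots> = w \<bullet> (Cov \<mu> *v w)"
    by (simp add: inner_vec_def matrix_vector_mult_def Cov_def sum_distrib_left mult_ac)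
  finally show ?thesis .
qed

lemma borel_measurable_matrix_vector_mult [measurable]:
  fixes A :: "real ^ 'n ^ 'm"
  shows "(*v) A \<in> borel_measurable borel"
  by (intro borel_measurable_continuous_onI linear_continuous_on) (simp add: linear_linear)

text \<open>This is \<open>potential_drift\<close> for the variable \<open>A *v z\<close>. With
  \<open>B = A ** Cov \<mu> ** transpose A\<close>, its second moment in direction \<open>v\<close>
  is \<open>v \<bullet> (B *v v)\<close>, bounded through \<open>lambda_max B\<close>, and its total
  second moment is \<open>trace B\<close>, so the trace condition becomes the gap required
  there.\<close>

lemma potential_drift_of_trace_gap:
  fixes \<mu> :: "(real ^ 'n) measure" and A :: "real ^ 'n ^ 'n"
  assumes \<mu>: "prob_measure_on_space \<mu>" "has_mean_zero \<mu>" "has_moments \<mu> (2 + \<beta>)" and \<beta>: "\<beta> > 0"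
    and gap: "trace (A ** Cov \<mu> ** transpose A) > 2 * lambda_max (A ** Cov \<mu> ** transpose A)"
  shows "\<forall>\<^sub>F a in at_right 0. \<forall>\<^sub>F K in at_top. \<forall>\<^sub>F c in at_right 0.
    \<forall>y. (\<integral>z. (K + (norm (y + A *v z))\<^sup>2) powr (-a) \<partial>\<mu>)
      \<le> (K + (norm y)\<^sup>2) powr (-a) - c * (K + (norm y)\<^sup>2) powr (-a - 1)"
proof -
  interpret prob_space \<mu>
    using \<mu> by (simp add: prob_measure_on_space_def)
  have [measurable_cong]: "sets \<mu> = sets borel"
    using \<mu> by (simp add: prob_measure_on_space_def)
  have int: "integrable \<mu> (\<lambda>z. z)" and mean: "(\<integral>z. z \<partial>\<mu>) = 0"
    using \<mu> by (auto simp: has_mean_zero_def)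
  have mom: "integrable \<mu> (\<lambda>z. norm z powr (2 + \<beta>))"
    using \<mu> by (simp add: has_moments_def)
  define B where "B = A ** Cov \<mu> ** transpose A"
  have "transpose (Cov \<mu>) = Cov \<mu>"
    by (simp add: Cov_def transpose_def mult.commute)
  then have sym: "transpose B = B"
    by (simp add: B_def matrix_transpose_mul transpose_transpose matrix_mul_assoc)
  have bl: "bounded_linear ((*v) A)"
    by (simp add: linear_linear)
  have "integrable \<mu> (\<lambda>z. z $ i * z $ j)" for i j
  proof (rule integrable_of_bound_powr_moment[OF _ mom \<beta>])
    show "norm (z $ i * z $ j) \<le> 1 * (norm z)\<^sup>2" for z :: "real ^ 'n"
      using mult_mono[OF component_le_norm_cart[of z i] component_le_norm_cart[of z j]]
      by (simp add: abs_mult power2_eq_square)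
  qed measurable
  note Cov = Cov_quadratic_form[OF this]
  have form: "(\<integral>z. (v \<bullet> (A *v z))\<^sup>2 \<partial>\<mu>) = v \<bullet> (B *v v)" for v
  proof -
    have A: "v \<bullet> (A *v z) = (transpose A *v v) \<bullet> z" for z
      by (simp add: dot_lmul_matrix transpose_matrix_vector)
    have "B *v v = A *v (Cov \<mu> *v (transpose A *v v))"
      by (simp only: B_def matrix_vector_mul_assoc matrix_mul_assoc)
    then show ?thesis
      by (simp only: A Cov)
  qed
  have "integrable \<mu> (\<lambda>z. (A *v z) $ i * (A *v z) $ i)" for i
  proof -
    have [measurable]: "(\<lambda>z. (A *v z) $ i) \<in> borel_measurable borel"
      unfolding cart_eq_inner_axis by measurable
    obtain C where C: "\<And>z. norm (A *v z) \<le> norm z * C"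
      using bounded_linear.bounded[OF bl] by blast
    show ?thesis
    proof (rule integrable_of_bound_powr_moment[OF _ mom \<beta>])
      show "norm ((A *v z) $ i * (A *v z) $ i) \<le> C\<^sup>2 * (norm z)\<^sup>2" for z
      proof -
        have "\<bar>(A *v z) $ i\<bar> \<le> norm z * C"
          using component_le_norm_cart C order_trans by blast
        from power_mono[OF this abs_ge_zero, of 2] show ?thesis
          by (simp add: power2_eq_square mult_ac)
      qed
    qed measurable
  qed
  then have "(\<integral>z. (norm (A *v z))\<^sup>2 \<partial>\<mu>) = (\<Sum>i\<in>UNIV. \<integral>z. ((A *v z) $ i)\<^sup>2 \<partial>\<mu>)"
    unfolding power2_norm_eq_inner inner_vec_def
    by (simp add: Bochner_Integration.integral_sum power2_eq_square)
  \<comment> \<open>\<open>form\<close> at the standard basis vectors yields the diagonal entries of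
    \<open>B\<close>.\<close>
  also have "\<dots> = (\<Sum>i\<in>UNIV. axis i 1 \<bullet> (B *v axis i 1))"
    by (simp add: form[symmetric] inner_axis')
  also have "\<dots> = trace B"
    by (simp add: trace_def inner_axis' matrix_vector_mult_basis column_def)
  finally have tr: "(\<integral>z. (norm (A *v z))\<^sup>2 \<partial>\<mu>) = trace B" .
  show ?thesis
  proof (rule potential_drift[where \<beta> = \<beta> and lam = "lambda_max B"])
    show "integrable \<mu> ((*v) A)" "(\<integral>z. A *v z \<partial>\<mu>) = 0"
      using integrable_bounded_linear[OF bl int] integral_bounded_linear[OF bl int] mean by auto
    show "integrable \<mu> (\<lambda>z. norm (A *v z) powr (2 + \<beta>))"
    proof -
      obtain C where C: "\<And>z. norm (A *v z) \<le> norm z * C" "C > 0"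
        using bounded_linear.pos_bounded[OF bl] by blast
      have "norm (A *v z) powr (2 + \<beta>) \<le> norm z powr (2 + \<beta>) * C powr (2 + \<beta>)" for z
        using powr_mono2[of "2 + \<beta>" "norm (A *v z)" "norm z * C"] C \<beta> by (simp add: powr_mult)
      then show ?thesis
        by (intro Bochner_Integration.integrable_bound[OF integrable_mult_left[OF mom, of "C powr (2 + \<beta>)"]])
          auto
    qed
    show "2 * lambda_max B < (\<integral>z. (norm (A *v z))\<^sup>2 \<partial>\<mu>)"
      using gap by (simp add: tr B_def)
  qed (auto simp: form \<beta> quadratic_form_le_lambda_max[OF sym])
qed

section \<open>Independence and almost sure convergence\<close>

text \<open>Independence makes the joint law of \<open>W\<close> and \<open>V\<close> a product, so
  Fubini integrates over \<open>V\<close> first with \<open>W\<close> frozen; this does the work of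
  a conditional expectation. Independence is stated for \<open>G\<close> and \<open>H\<close> to
  match \<open>indep_past\<close>.\<close>

lemma (in prob_space) expectation_indep_le:
  fixes g :: "'b \<times> 'c \<Rightarrow> real"
  assumes W: "subalgebra M G" "W \<in> measurable G N" and V: "V \<in> measurable H L" "space H = space M"
    and ind: "indep_set (sets G) (sets H)"
    and g[measurable]: "g \<in> borel_measurable (N \<Otimes>\<^sub>M L)" and gb: "\<And>x. \<bar>g x\<bar> \<le> C"
    and h[measurable]: "h \<in> borel_measurable N" and hb: "\<And>x. \<bar>h x\<bar> \<le> C"
    and le: "\<And>w. w \<in> space N \<Longrightarrow> (\<integral>v. g (w, v) \<partial>distr M L V) \<le> h w"
  shows "expectation (\<lambda>\<omega>. g (W \<omega>, V \<omega>)) \<le> expectation (\<lambda>\<omega>. h (W \<omega>))"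
proof -
  have "sets H \<subseteq> events"
    using ind by (rule indep_setD_ev2)
  have sG: "space G = space M"
    using W by (simp add: subalgebra_def)
  have [measurable]: "W \<in> measurable M N" "V \<in> measurable M L"
    using measurable_from_subalg[OF W] measurable_from_subalg[of M H, OF _ V(1)] V(2) \<open>sets H \<subseteq> events\<close>
    by (simp_all add: subalgebra_def)
  interpret W: prob_space "distr M N W"
    by (rule prob_space_distr) simp
  interpret V: prob_space "distr M L V"
    by (rule prob_space_distr) simp
  interpret P: pair_prob_space "distr M N W" "distr M L V" ..
  have eq: "distr M N W \<Otimes>\<^sub>M distr M L V = distr M (N \<Otimes>\<^sub>M L) (\<lambda>x. (W x, V x))"
  proof (rule pair_measure_eqI)
    fix A B assume AB: "A \<in> sets (distr M N W)" "B \<in> sets (distr M L V)"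
    let ?A = "W -` A \<inter> space M" and ?B = "V -` B \<inter> space M"
    have "?A \<in> sets G" "?B \<in> sets H"
      using AB measurable_sets[OF W(2), of A] measurable_sets[OF V(1), of B] by (simp_all add: sG V(2))
    then have "prob (?A \<inter> ?B) = prob ?A * prob ?B"
      by (rule indep_setD[OF ind])
    moreover have "(\<lambda>x. (W x, V x)) -` (A \<times> B) \<inter> space M = ?A \<inter> ?B"
      by auto
    ultimately show "emeasure (distr M N W) A * emeasure (distr M L V) B
        = emeasure (distr M (N \<Otimes>\<^sub>M L) (\<lambda>x. (W x, V x))) (A \<times> B)"
      using AB by (simp add: emeasure_distr emeasure_eq_measure ennreal_mult'')
  qed (simp_all add: W.sigma_finite_measure_axioms V.sigma_finite_measure_axioms)
  have int: "integrable (distr M N W \<Otimes>\<^sub>M distr M L V) g"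
    by (rule P.integrable_const_bound[of _ C]) (auto simp: gb)
  have "expectation (\<lambda>\<omega>. g (W \<omega>, V \<omega>)) = integral\<^sup>L (distr M N W \<Otimes>\<^sub>M distr M L V) g"
    by (simp add: eq integral_distr)
  also have "\<dots> = (\<integral>w. (\<integral>v. g (w, v) \<partial>distr M L V) \<partial>distr M N W)"
    by (rule P.integral_fst'[OF int, symmetric])
  also have "\<dots> \<le> (\<integral>w. h w \<partial>distr M N W)"
    by (intro integral_mono P.integrable_fst'[OF int] W.integrable_const_bound[of _ C])
      (auto simp: le hb)
  also have "\<dots> = expectation (\<lambda>\<omega>. h (W \<omega>))"
    by (simp add: integral_distr)
  finally show ?thesis .
qed

text \<open>Sum and integral of nonnegative functions may be exchanged, so the series has finite
  expectation. It therefore converges almost surely, and its terms tend to 0.\<close>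

lemma (in prob_space) AE_tendsto_zero_of_sum_expectation_bounded:
  fixes f :: "nat \<Rightarrow> 'a \<Rightarrow> real"
  assumes int: "\<And>n. integrable M (f n)" and nonneg: "\<And>n x. 0 \<le> f n x"
    and bound: "\<And>N. (\<Sum>n<N. expectation (f n)) \<le> C"
  shows "AE x in M. (\<lambda>n. f n x) \<longlonglongrightarrow> 0"
proof -
  have [measurable]: "f n \<in> borel_measurable M" for n
    using int by blast
  have "(\<integral>\<^sup>+x. (\<Sum>n. ennreal (f n x)) \<partial>M) = (\<Sum>n. ennreal (expectation (f n)))"
    using int nonneg by (simp add: nn_integral_suminf nn_integral_eq_integral)
  also have "\<dots> \<le> ennreal C"
  proof (rule suminf_le_const)
    show "(\<Sum>n<N. ennreal (expectation (f n))) \<le> ennreal C" for N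
      using bound[of N] nonneg by (simp add: sum_ennreal ennreal_leI)
  qed simp
  finally have "(\<integral>\<^sup>+x. (\<Sum>n. ennreal (f n x)) \<partial>M) \<noteq> \<infinity>"
    by (auto simp: top_unique)
  then have "AE x in M. (\<Sum>n. ennreal (f n x)) \<noteq> \<infinity>"
    by (intro nn_integral_PInf_AE) auto
  then show ?thesis
    by eventually_elim (auto intro!: summable_LIMSEQ_zero summable_suminf_not_top nonneg)
qed

section \<open>The walk under an adapted rule\<close>

context increments
begin

lemma walk_measurable:
  assumes "adapted_rule F k \<l>"
  shows "walk \<xi> \<l> n \<in> borel_measurable (F n)"
proof (induction n)
  case (Suc n)
  have F: "subalgebra (F (Suc n)) (F n)"
    using sets_F_mono[of n "Suc n"] by (simp add: subalgebra_def space_F)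
  have [measurable]: "walk \<xi> \<l> n \<in> borel_measurable (F (Suc n))"
    using measurable_from_subalg[OF F Suc] .
  have l: "\<l> n \<in> measurable (F (Suc n)) (count_space {1..k})"
    using assms unfolding adapted_rule_def by (intro measurable_from_subalg[OF F]) (rule spec)
  \<comment> \<open>The index of the increment is random but takes only finitely many values, so
    measurability for each fixed index suffices.\<close>
  have [measurable]: "(\<lambda>\<omega>. \<xi> (\<l> n \<omega>) (Suc n) \<omega>) \<in> borel_measurable (F (Suc n))"
    by (rule measurable_compose_countable'[OF adapted l countable_finite[OF finite_atLeastAtMost]]) simp_all
  have "walk \<xi> \<l> (Suc n) = (\<lambda>\<omega>. walk \<xi> \<l> n \<omega> + \<xi> (\<l> n \<omega>) (Suc n) \<omega>)"
    by (simp add: fun_eq_iff)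
  then show ?case
    by (simp only:) measurable
next
  case 0
  have "walk \<xi> \<l> 0 = (\<lambda>_. 0)"
    by (simp add: fun_eq_iff)
  then show ?case
    by simp
qed

text \<open>The expectation is split by the value \<open>j\<close> of \<open>\<l> n\<close>. This
  value and the current position are known at time \<open>n\<close>, while the next increment with
  law \<open>\<mu> j\<close> is independent of \<open>F n\<close>, so the one-step bound applies
  with position and law held fixed. A bound shared by all laws thus survives any adapted
  choice.\<close>

lemma expectation_walk_Suc_le:
  assumes rule: "adapted_rule F k \<l>"
    and g[measurable]: "g \<in> borel_measurable borel" and gb: "\<And>x. \<bar>g x\<bar> \<le> (C :: real)"
    and h[measurable]: "h \<in> borel_measurable borel" and hb: "\<And>x. \<bar>h x\<bar> \<le> C"
    and le: "\<And>j x. j \<in> {1..k} \<Longrightarrow> (\<integral>z. g (x + z) \<partial>\<mu> j) \<le> h x"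
  shows "expectation (\<lambda>\<omega>. g (walk \<xi> \<l> (Suc n) \<omega>)) \<le> expectation (\<lambda>\<omega>. h (walk \<xi> \<l> n \<omega>))"
proof -
  have l: "\<l> n \<in> measurable (F n) (count_space {1..k})"
    using rule by (simp add: adapted_rule_def)
  have [measurable]: "\<l> n \<in> measurable \<Omega> (count_space {1..k})"
    by (rule measurable_from_subalg[OF subalgebra_F l])
  have \<xi>: "\<xi> j (Suc n) \<in> borel_measurable \<Omega>" if "j \<in> {1..k}" for j
    using measurable_from_subalg[OF subalgebra_F adapted[OF that]] by simp
  have [measurable]: "walk \<xi> \<l> n \<in> borel_measurable \<Omega>"
    by (rule measurable_from_subalg[OF subalgebra_F walk_measurable[OF rule]])
  have ind[measurable]: "(\<lambda>\<omega>. indicat_real {j} (\<l> n \<omega>)) \<in> borel_measurable \<Omega>" for j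
    by (rule measurable_compose[OF \<open>\<l> n \<in> measurable \<Omega> _\<close> borel_measurable_count_space])
  have split: "(\<Sum>j\<in>{1..k}. indicat_real {j} (\<l> n \<omega>) * u j) = u (\<l> n \<omega>)"
    if "\<omega> \<in> space \<Omega>" for \<omega> and u :: "nat \<Rightarrow> real"
  proof -
    have "\<l> n \<omega> \<in> {1..k}"
      using measurable_space[OF \<open>\<l> n \<in> measurable \<Omega> _\<close> that] by simp
    then show ?thesis
      by (subst sum.remove[of _ "\<l> n \<omega>"]) (auto simp: indicator_def)
  qed
  have "C \<ge> 0"
    using gb[of 0] by linarith
  have bound: "\<bar>indicat_real S i * u\<bar> \<le> C" if "\<bar>u\<bar> \<le> C" for S :: "nat set" and i u
    using that \<open>C \<ge> 0\<close> by (simp add: indicator_def)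
  have int_g: "integrable \<Omega> (\<lambda>\<omega>. indicat_real {j} (\<l> n \<omega>) * g (walk \<xi> \<l> n \<omega> + \<xi> j (Suc n) \<omega>))"
    if "j \<in> {1..k}" for j
  proof -
    note [measurable] = \<xi>[OF that]
    show ?thesis
      by (intro integrable_const_bound[of _ C]) (auto intro!: bound gb)
  qed
  have int_h: "integrable \<Omega> (\<lambda>\<omega>. indicat_real {j} (\<l> n \<omega>) * h (walk \<xi> \<l> n \<omega>))" for j
    by (intro integrable_const_bound[of _ C]) (auto intro!: bound hb)
  have "expectation (\<lambda>\<omega>. g (walk \<xi> \<l> (Suc n) \<omega>)) = expectation (\<lambda>\<omega>. \<Sum>j\<in>{1..k}.
      indicat_real {j} (\<l> n \<omega>) * g (walk \<xi> \<l> n \<omega> + \<xi> j (Suc n) \<omega>))"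
    by (rule Bochner_Integration.integral_cong[OF refl]) (simp only: split walk.simps)
  also have "\<dots> = (\<Sum>j\<in>{1..k}. expectation (\<lambda>\<omega>.
      indicat_real {j} (\<l> n \<omega>) * g (walk \<xi> \<l> n \<omega> + \<xi> j (Suc n) \<omega>)))"
    by (intro Bochner_Integration.integral_sum int_g)
  also have "\<dots> \<le> (\<Sum>j\<in>{1..k}. expectation (\<lambda>\<omega>. indicat_real {j} (\<l> n \<omega>) * h (walk \<xi> \<l> n \<omega>)))"
  proof (rule sum_mono)
    fix j assume j: "j \<in> {1..k}"
    let ?N = "count_space {1..k} \<Otimes>\<^sub>M (borel :: (real ^ 'n) measure)"
    let ?S = "vimage_algebra (space \<Omega>) (\<lambda>\<omega>. \<lambda>j\<in>{1..k}. \<xi> j (n + 1) \<omega>) (Pi\<^sub>M {1..k} (\<lambda>_. borel))"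
    \<comment> \<open>\<open>indep_past\<close> concerns the sigma-algebra generated by the joint
      vector of increments, for which each coordinate is measurable.\<close>
    have V: "\<xi> j (Suc n) \<in> borel_measurable ?S"
    proof -
      have "(\<lambda>\<omega>. (\<lambda>i\<in>{1..k}. \<xi> i (n + 1) \<omega>) j) \<in> borel_measurable ?S"
        by (rule measurable_compose[OF measurable_vimage_algebra1 measurable_component_singleton[OF j]])
          (auto simp: space_PiM)
      then show ?thesis
        using j by simp
    qed
    have W: "(\<lambda>\<omega>. (\<l> n \<omega>, walk \<xi> \<l> n \<omega>)) \<in> measurable (F n) ?N"
      using l walk_measurable[OF rule] by measurable
    \<comment> \<open>The indicator belongs to the part known at time \<open>n\<close>; for fixed
      \<open>w\<close> it is a nonnegative constant factor of the inner integral.\<close>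
    let ?G = "\<lambda>p. indicat_real {j} (fst (fst p)) * g (snd (fst p) + snd p)"
    let ?H = "\<lambda>p. indicat_real {j} (fst p) * h (snd p)"
    have [measurable]: "(\<lambda>p. indicat_real {j} (fst p)) \<in> borel_measurable ?N"
      by (rule measurable_compose[OF measurable_fst borel_measurable_count_space])
    have [measurable]: "(\<lambda>p. indicat_real {j} (fst (fst p))) \<in> borel_measurable (?N \<Otimes>\<^sub>M (borel :: (real ^ 'n) measure))"
      by (rule measurable_compose[OF measurable_fst]) fact
    have "expectation (\<lambda>\<omega>. ?G ((\<l> n \<omega>, walk \<xi> \<l> n \<omega>), \<xi> j (Suc n) \<omega>))
        \<le> expectation (\<lambda>\<omega>. ?H (\<l> n \<omega>, walk \<xi> \<l> n \<omega>))"
    proof (rule expectation_indep_le[where g = ?G and h = ?H, OF subalgebra_F W V _ indep_past])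
      show "(\<integral>v. ?G (w, v) \<partial>distr \<Omega> borel (\<xi> j (Suc n))) \<le> ?H w" for w
        using le[OF j, of "snd w"] law[OF j, of "Suc n"] by (simp add: mult_left_mono)
      show "\<bar>?G p\<bar> \<le> C" for p
        by (rule bound) (rule gb)
      show "\<bar>?H p\<bar> \<le> C" for p
        by (rule bound) (rule hb)
      show "?G \<in> borel_measurable (?N \<Otimes>\<^sub>M borel)"
        by measurable
      show "?H \<in> borel_measurable ?N"
        by measurable
    qed simp
    then show "expectation (\<lambda>\<omega>. indicat_real {j} (\<l> n \<omega>) * g (walk \<xi> \<l> n \<omega> + \<xi> j (Suc n) \<omega>))
        \<le> expectation (\<lambda>\<omega>. indicat_real {j} (\<l> n \<omega>) * h (walk \<xi> \<l> n \<omega>))"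
      by simp
  qed
  also have "\<dots> = expectation (\<lambda>\<omega>. \<Sum>j\<in>{1..k}. indicat_real {j} (\<l> n \<omega>) * h (walk \<xi> \<l> n \<omega>))"
    by (intro Bochner_Integration.integral_sum[symmetric] int_h)
  also have "\<dots> = expectation (\<lambda>\<omega>. h (walk \<xi> \<l> n \<omega>))"
    by (rule Bochner_Integration.integral_cong[OF refl]) (simp only: split walk.simps)
  finally show ?thesis .
qed

text \<open>Telescoping the drift bounds the summed expectations by the initial potential divided by
  \<open>c\<close>. Divergence passes from \<open>A *v x\<close> to \<open>x\<close> because a
  linear map is bounded.\<close>

lemma transient_of_potential_drift:
  fixes A :: "real ^ 'n ^ 'n"
  assumes rule: "adapted_rule F k \<l>" and a: "a > 0" and K: "K \<ge> 1" and c: "c > 0"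
    and drift: "\<And>j y. j \<in> {1..k} \<Longrightarrow> (\<integral>z. (K + (norm (y + A *v z))\<^sup>2) powr (-a) \<partial>\<mu> j)
      \<le> (K + (norm y)\<^sup>2) powr (-a) - c * (K + (norm y)\<^sup>2) powr (-a - 1)"
  shows "transient \<Omega> (walk \<xi> \<l>)"
proof -
  define s where "s x = K + (norm (A *v x))\<^sup>2" for x
  have s1: "s x \<ge> 1" for x
    using K by (simp add: s_def add_increasing2)
  have [measurable]: "walk \<xi> \<l> n \<in> borel_measurable \<Omega>" for n
    by (rule measurable_from_subalg[OF subalgebra_F walk_measurable[OF rule]])
  have [measurable]: "s \<in> borel_measurable borel"
    unfolding s_def by measurable
  have le1: "s x powr b \<le> 1" if "b \<le> 0" for x b
    using powr_mono[OF that s1[of x]] s1[of x] by simp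
  have int: "integrable \<Omega> (\<lambda>\<omega>. s (walk \<xi> \<l> n \<omega>) powr b)" if "b \<le> 0" for b n
    using le1[OF that] by (intro integrable_const_bound[of _ 1]) auto
  let ?e = "\<lambda>b n. expectation (\<lambda>\<omega>. s (walk \<xi> \<l> n \<omega>) powr b)"
  have step: "?e (-a) (Suc n) \<le> ?e (-a) n - c * ?e (-a - 1) n" for n
  proof -
    \<comment> \<open>Since \<open>s x \<ge> 1\<close>, powers with nonpositive exponents lie
      between 0 and 1, hence the common bound \<open>1 + c\<close>.\<close>
    have "?e (-a) (Suc n) \<le> expectation (\<lambda>\<omega>. s (walk \<xi> \<l> n \<omega>) powr (-a) - c * s (walk \<xi> \<l> n \<omega>) powr (-a - 1))"
    proof (rule expectation_walk_Suc_le[OF rule, where C = "1 + c"])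
      show "\<bar>s x powr (-a) - c * s x powr (-a - 1)\<bar> \<le> 1 + c" for x
      proof -
        have "\<bar>s x powr (-a)\<bar> \<le> 1" "\<bar>c * s x powr (-a - 1)\<bar> \<le> c"
          using le1[of "-a" x] le1[of "-a - 1" x] a c by (auto simp: abs_mult mult_left_le)
        then show ?thesis
          by linarith
      qed
      show "\<bar>s x powr (-a)\<bar> \<le> 1 + c" for x
        using le1[of "-a" x] a c by simp
      show "(\<integral>z. s (x + z) powr (-a) \<partial>\<mu> j) \<le> s x powr (-a) - c * s x powr (-a - 1)"
        if "j \<in> {1..k}" for j x
        using drift[OF that, of "A *v x"] by (simp add: s_def matrix_vector_right_distrib)
    qed auto
    also have "\<dots> = ?e (-a) n - c * ?e (-a - 1) n"
      using a int by simp
    finally show ?thesis .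
  qed
  have tele: "(\<Sum>n<N. c * ?e (-a - 1) n) \<le> ?e (-a) 0 - ?e (-a) N" for N
  proof (induction N)
    case (Suc N)
    then show ?case
      using step[of N] by simp
  qed simp
  have "(\<Sum>n<N. c * ?e (-a - 1) n) \<le> ?e (-a) 0" for N
    by (rule order_trans[OF tele]) simp
  then have "(\<Sum>n<N. ?e (-a - 1) n) \<le> ?e (-a) 0 / c" for N
    using c by (simp add: sum_distrib_left[symmetric] field_simps)
  then have "AE \<omega> in \<Omega>. (\<lambda>n. s (walk \<xi> \<l> n \<omega>) powr (-a - 1)) \<longlonglongrightarrow> 0"
    using a by (intro AE_tendsto_zero_of_sum_expectation_bounded[where C = "?e (-a) 0 / c"] int) auto
  moreover obtain C where C: "\<And>z. norm (A *v z) \<le> norm z * C" "C > 0"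
    using bounded_linear.pos_bounded[of "(*v) A"] by (auto simp: linear_linear)
  have "filterlim (\<lambda>n. norm (x n)) at_top sequentially"
    if x: "(\<lambda>n. s (x n) powr (-a - 1)) \<longlonglongrightarrow> 0" for x :: "nat \<Rightarrow> real ^ 'n"
    unfolding filterlim_at_top
  proof
    fix Q :: real
    \<comment> \<open>\<open>R\<close> bounds \<open>s\<close> on the ball
      \<open>norm x < Q\<close>, so a value of \<open>s (x n) powr (-a - 1)\<close> below
      \<open>R powr (-a - 1)\<close> excludes that ball. The absolute value covers negative
      \<open>Q\<close>.\<close>
    define R where "R = K + (\<bar>Q\<bar> * C)\<^sup>2"
    have R: "R > 0"
      using K by (simp add: R_def add_pos_nonneg)
    then have "\<forall>\<^sub>F n in sequentially. s (x n) powr (-a - 1) < R powr (-a - 1)"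
      by (intro order_tendstoD(2)[OF x]) simp
    then show "\<forall>\<^sub>F n in sequentially. Q \<le> norm (x n)"
    proof eventually_elim
      case (elim n)
      show ?case
      proof (rule ccontr)
        assume "\<not> Q \<le> norm (x n)"
        then have "norm (x n) * C \<le> \<bar>Q\<bar> * C"
          using C by (intro mult_right_mono) auto
        then have "norm (A *v x n) \<le> \<bar>Q\<bar> * C"
          using C order_trans by blast
        then have "s (x n) \<le> R"
          unfolding s_def R_def by (intro add_left_mono power_mono) auto
        then have "R powr (-a - 1) \<le> s (x n) powr (-a - 1)"
          using a s1[of "x n"] by (intro powr_mono2') auto
        with elim show False
          by simp
      qed
    qed
  qed
  ultimately show ?thesis
    unfolding transient_def by (auto elim: eventually_mono)
qed

end

section \<open>A common potential for all laws\<close>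

theorem theorem1p3:
  fixes k :: nat
    and \<mu> :: "nat \<Rightarrow> (real ^ 'n) measure"
    and \<beta> :: real
    and \<Omega> :: "'a measure"
    and F :: "nat \<Rightarrow> 'a measure"
    and \<xi> :: "nat \<Rightarrow> nat \<Rightarrow> 'a \<Rightarrow> real ^ 'n"
    and \<l> :: "nat \<Rightarrow> 'a \<Rightarrow> nat"
  assumes "CARD('n) \<ge> 3"
    and "\<And>i. i \<in> {1..k} \<Longrightarrow> prob_measure_on_space (\<mu> i)"
    and "\<And>i. i \<in> {1..k} \<Longrightarrow> has_mean_zero (\<mu> i)"
    and "\<beta> > 0"
    and "\<And>i. i \<in> {1..k} \<Longrightarrow> has_moments (\<mu> i) (2 + \<beta>)"
    and "\<exists>A :: real ^ 'n ^ 'n. \<forall>i\<in>{1..k}.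
           trace (A ** Cov (\<mu> i) ** transpose A) > 2 * lambda_max (A ** Cov (\<mu> i) ** transpose A)"
    and "increments \<Omega> F k \<mu> \<xi>"
    and "adapted_rule F k \<l>"
  shows "transient \<Omega> (walk \<xi> \<l>)"
proof -
  interpret increments \<Omega> F k \<mu> \<xi>
    by fact
  obtain A :: "real ^ 'n ^ 'n" where A: "\<forall>i\<in>{1..k}.
      trace (A ** Cov (\<mu> i) ** transpose A) > 2 * lambda_max (A ** Cov (\<mu> i) ** transpose A)"
    using assms by blast
  let ?drift = "\<lambda>a K c i. \<forall>y. (\<integral>z. (K + (norm (y + A *v z))\<^sup>2) powr (-a) \<partial>\<mu> i)
      \<le> (K + (norm y)\<^sup>2) powr (-a) - c * (K + (norm y)\<^sup>2) powr (-a - 1)"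
  have "\<forall>i\<in>{1..k}. \<forall>\<^sub>F a in at_right 0. \<forall>\<^sub>F K in at_top. \<forall>\<^sub>F c in at_right 0. ?drift a K c i"
    using assms A by (intro ballI potential_drift_of_trace_gap[where \<beta> = \<beta>]) auto
  \<comment> \<open>A finite conjunction commutes with each of the three filters, so one triple
    \<open>a\<close>, \<open>K\<close>, \<open>c\<close> serves all laws. The constants are then
    extracted from the outermost filter inwards.\<close>
  then have ev: "\<forall>\<^sub>F a in at_right 0. \<forall>\<^sub>F K in at_top. \<forall>\<^sub>F c in at_right 0. \<forall>i\<in>{1..k}. ?drift a K c i"
    by (simp only: eventually_ball_finite_distrib finite_atLeastAtMost)
  have pos: "\<forall>\<^sub>F x :: real in at_right 0. x > 0"
    by (simp add: eventually_at_right_less)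
  from eventually_happens'[OF trivial_limit_at_right_real eventually_conj[OF pos ev]]
  obtain a where a: "a > 0" and ev: "\<forall>\<^sub>F K in at_top. \<forall>\<^sub>F c in at_right 0. \<forall>i\<in>{1..k}. ?drift a K c i"
    by (elim exE conjE)
  from eventually_happens'[OF trivial_limit_at_top_linorder eventually_conj[OF eventually_ge_at_top[of 1] ev]]
  obtain K where K: "K \<ge> 1" and ev: "\<forall>\<^sub>F c in at_right 0. \<forall>i\<in>{1..k}. ?drift a K c i"
    by (elim exE conjE)
  from eventually_happens'[OF trivial_limit_at_right_real eventually_conj[OF pos ev]]
  obtain c where c: "c > 0" and drift: "\<forall>i\<in>{1..k}. ?drift a K c i"
    by (elim exE conjE)
  show ?thesis
    by (rule transient_of_potential_drift[OF assms(8) a K c, of A]) (use drift in blast)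
qed

end
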